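(* Let $n\ge 1$ be an integer and let $Id_{2n+1}$ be the identity permutation in $S_{2n+1}$. Each of the following permutations in $S_{4n+2}$ (left Pastings) is a simple permutation of mixed order $4n+2$: (1) $\alpha_{2n+1}\mid\diamond\, Id_{2n+1}$; (2) $\beta_{2n+1}\mid\diamond\, Id_{2n+1}$; (3) $Id_{2n+1}\mid\diamond\,\alpha_{2n+1}$; (4) $Id_{2n+1}\mid\diamond\,\beta_{2n+1}$.
   Context: $S_N$ denotes the group of permutations of $\{1,\dots,N\}$; its elements are called permutations of order $N$. Simple permutations of odd order. For $n\ge 1$, the simple permutations of odd order $2n+1$ are the two permutations $\alpha_{2n+1},\beta_{2n+1}\in S_{2n+1}$ defined by: - $\alpha_{2n+1}(i)=2n+2-i$ for $1\le i\le n$; $\alpha_{2n+1}(i)=2n+1-i$ for $n+1\le i\le 2n$; $\alpha_{2n+1}(2n+1)=n+1$. - $\beta_{2n+1}(1)=n+1$; $\beta_{2n+1}(i)=2n+3-i$ for $2\le i\le n+1$; $\beta_{2n+1}(i)=2n+2-i$ for $n+2\le i\le 2n+1$. (For example, in one-line notation, $\alpha_3=(3\,1\,2)$, $\beta_3=(2\,3\,1)$, $\alpha_5=(5\,4\,2\,1\,3)$, $\beta_5=(3\,5\,4\,2\,1)$.) Blocks. $P(4n+2,2,1)=\{1,\dots,2n+1\}$ and $P(4n+2,2,2)=\{2n+2,\dots,4n+2\}$. Simple permutations of mixed order $4n+2$. A permutation $\theta\in S_{4n+2}$ is simple (of mixed order $4n+2$) if (a) $\theta[P(4n+2,2,j)]=P(4n+2,2,\phi(j))$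 for $j=1,2$, where $\phi$ is the transposition exchanging $1$ and $2$; and (b) for each $j\in\{1,2\}$, the restriction of $\theta^2$ to $P(4n+2,2,j)$ is a simple permutation of odd order $2n+1$, i.e., after identifying $P(4n+2,2,j)$ with $\{1,\dots,2n+1\}$ by the order-preserving bijection, it equals $\alpha_{2n+1}$ or $\beta_{2n+1}$. Left Pasting. For $\alpha\in S_m$, $\beta\in S_k$, the permutation $\alpha\mid\diamond\beta\in S_{m+k}$ is defined by $(\alpha\mid\diamond\beta)(i)=\alpha(i)+k$ for $1\le i\le m$ and $(\alpha\mid\diamond\beta)(m+i)=\beta(i)$ for $1\le i\le k$. *)

theory Defs
  imports Main "HOL-Combinatorics.Permutations"
begin

text \<open>An element of \<open>S\<^sub>N\<close> is a function \<open>\<sigma> :: nat \<Rightarrow> nat\<close> with \<open>\<sigma> permutes {1..N}\<close>; in particular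
  it is the identity outside \<open>{1..N}\<close>. This is what the final \<open>else\<close> branches below are for.\<close>

definition alpha_perm :: "nat \<Rightarrow> nat \<Rightarrow> nat" where
  "alpha_perm n i =
     (if 1 \<le> i \<and> i \<le> n then 2 * n + 2 - i
      else if n + 1 \<le> i \<and> i \<le> 2 * n then 2 * n + 1 - i
      else if i = 2 * n + 1 then n + 1
      else i)"

definition beta_perm :: "nat \<Rightarrow> nat \<Rightarrow> nat" where
  "beta_perm n i =
     (if i = 1 then n + 1
      else if 2 \<le> i \<and> i \<le> n + 1 then 2 * n + 3 - i
      else if n + 2 \<le> i \<and> i \<le> 2 * n + 1 then 2 * n + 2 - i
      else i)"

text \<open>The parameter \<open>n\<close> stands for the order \<open>2n + 1\<close>, here and in \<open>simple_mixed\<close> for \<open>4n + 2\<close>.\<close>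

definition simple_odd :: "nat \<Rightarrow> (nat \<Rightarrow> nat) \<Rightarrow> bool" where
  "simple_odd n \<sigma> \<longleftrightarrow> n \<ge> 1 \<and> (\<sigma> = alpha_perm n \<or> \<sigma> = beta_perm n)"

text \<open>\<open>block n j\<close> is \<open>P(4n + 2, 2, j)\<close>; it is used for \<open>j \<in> {1, 2}\<close> only.\<close>

definition block :: "nat \<Rightarrow> nat \<Rightarrow> nat set" where
  "block n j = (if j = 1 then {1..2 * n + 1} else {2 * n + 2..4 * n + 2})"

text \<open>In the second condition \<open>e\<close> is, on \<open>{1..2n + 1}\<close>, the unique order-preserving bijection onto the
  block, and the equation says that the restriction of \<open>\<theta>\<^sup>2\<close> to the block is \<open>\<sigma>\<close> transported along \<open>e\<close>.
  The choice of \<open>\<sigma>\<close> may depend on the block.\<close>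

definition simple_mixed :: "nat \<Rightarrow> (nat \<Rightarrow> nat) \<Rightarrow> bool" where
  "simple_mixed n \<theta> \<longleftrightarrow>
     \<theta> permutes {1..4 * n + 2} \<and>
     (\<forall>j\<in>{1, 2}. \<theta> ` block n j = block n (transpose 1 2 j)) \<and>
     (\<forall>j\<in>{1, 2}. \<exists>e \<sigma>.
        bij_betw e {1..2 * n + 1} (block n j) \<and> strict_mono_on {1..2 * n + 1} e \<and>
        simple_odd n \<sigma> \<and>
        (\<forall>i\<in>{1..2 * n + 1}. (\<theta> ^^ 2) (e i) = e (\<sigma> i)))"

text \<open>The left pasting of \<open>\<alpha> \<in> S\<^sub>m\<close> and \<open>\<beta> \<in> S\<^sub>k\<close>. The orders \<open>m\<close> and \<open>k\<close> are explicit arguments because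
  they cannot be recovered from the functions.\<close>

definition left_pasting :: "nat \<Rightarrow> nat \<Rightarrow> (nat \<Rightarrow> nat) \<Rightarrow> (nat \<Rightarrow> nat) \<Rightarrow> nat \<Rightarrow> nat" where
  "left_pasting m k \<alpha> \<beta> i =
     (if 1 \<le> i \<and> i \<le> m then \<alpha> i + k
      else if m + 1 \<le> i \<and> i \<le> m + k then \<beta> (i - m)
      else i)"

end

theory Submission
  imports Defs
begin

text \<open>
  A left pasting of two permutations of the same order \<open>m\<close> exchanges the lower half
  \<open>{1..m}\<close> and the upper half \<open>{m + 1..2m}\<close>. Its square therefore preserves each half, and there
  it composes the two given permutations \<open>\<sigma>\<close> and \<open>\<tau>\<close>: a point of the lower half is moved first by
  \<open>\<sigma>\<close> and then by \<open>\<tau>\<close>, a point of the upper half first by \<open>\<tau>\<close> and then by \<open>\<sigma>\<close>. Hence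
  \<open>left_pasting m m \<sigma> \<tau>\<close>, with \<open>m = 2n + 1\<close>, is simple as soon as both \<open>\<tau> \<circ> \<sigma>\<close> and \<open>\<sigma> \<circ> \<tau>\<close> are
  simple of odd order (\<open>simple_mixed_left_pasting\<close>). If one factor is the identity, both products
  are the other factor, so all four permutations are instances of this one principle.
\<close>

lemma permutes_if_inj_on_subset:
  assumes "finite A" "inj_on f A" "f ` A \<subseteq> A" "\<And>x. x \<notin> A \<Longrightarrow> f x = x"
  shows "f permutes A"
  using assms by (auto intro!: bij_imp_permutes simp: bij_betw_def endo_inj_surj)

lemma alpha_perm_permutes: "alpha_perm n permutes {1..2 * n + 1}"
proof (rule permutes_if_inj_on_subset)
  show "inj_on (alpha_perm n) {1..2 * n + 1}"
    by (rule inj_onI) (auto simp: alpha_perm_def split: if_splits)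
  show "alpha_perm n ` {1..2 * n + 1} \<subseteq> {1..2 * n + 1}"
    by (auto simp: alpha_perm_def)
qed (auto simp: alpha_perm_def)

lemma beta_perm_permutes: "beta_perm n permutes {1..2 * n + 1}"
proof (rule permutes_if_inj_on_subset)
  show "inj_on (beta_perm n) {1..2 * n + 1}"
    by (rule inj_onI) (auto simp: beta_perm_def split: if_splits)
  show "beta_perm n ` {1..2 * n + 1} \<subseteq> {1..2 * n + 1}"
    by (auto simp: beta_perm_def)
qed (auto simp: beta_perm_def)

lemma left_pasting_lower: "i \<in> {1..m} \<Longrightarrow> left_pasting m k \<sigma> \<tau> i = \<sigma> i + k"
  by (simp add: left_pasting_def)

lemma left_pasting_upper: "i \<in> {1..k} \<Longrightarrow> left_pasting m k \<sigma> \<tau> (i + m) = \<tau> i"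
  by (auto simp: left_pasting_def)

lemma left_pasting_image_lower:
  assumes "\<sigma> permutes {1..m}"
  shows "left_pasting m k \<sigma> \<tau> ` {1..m} = {k + 1..k + m}"
proof -
  have "left_pasting m k \<sigma> \<tau> ` {1..m} = (\<lambda>i. i + k) ` \<sigma> ` {1..m}"
    by (simp add: image_image left_pasting_lower)
  also have "\<dots> = {k + 1..k + m}"
    unfolding permutes_image[OF assms] by (simp add: add.commute)
  finally show ?thesis .
qed

lemma left_pasting_image_upper:
  assumes "\<tau> permutes {1..k}"
  shows "left_pasting m k \<sigma> \<tau> ` {m + 1..m + k} = {1..k}"
proof -
  have "{m + 1..m + k} = (\<lambda>i. i + m) ` {1..k}"
    by (simp add: add.commute)
  then have "left_pasting m k \<sigma> \<tau> ` {m + 1..m + k} = \<tau> ` {1..k}"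
    by (simp add: image_image left_pasting_upper del: image_add_atLeastAtMost')
  then show ?thesis
    by (simp only: permutes_image[OF assms])
qed

text \<open>The two images together cover \<open>{1..m + k}\<close>, and a surjection of a finite set onto itself is
  a bijection.\<close>

lemma left_pasting_permutes:
  assumes "\<sigma> permutes {1..m}" "\<tau> permutes {1..k}"
  shows "left_pasting m k \<sigma> \<tau> permutes {1..m + k}"
proof (rule bij_imp_permutes)
  let ?\<theta> = "left_pasting m k \<sigma> \<tau>"
  have "{1..m + k} = {1..m} \<union> {m + 1..m + k}"
    by auto
  then have "?\<theta> ` {1..m + k} = {k + 1..k + m} \<union> {1..k}"
    using left_pasting_image_lower[OF assms(1)] left_pasting_image_upper[OF assms(2)]
    by (simp add: image_Un)
  then have "?\<theta> ` {1..m + k} = {1..m + k}"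
    by auto
  then show "bij_betw ?\<theta> {1..m + k} {1..m + k}"
    by (simp add: bij_betw_def eq_card_imp_inj_on)
qed (auto simp: left_pasting_def)

lemma left_pasting_square_lower:
  assumes "\<sigma> permutes {1..m}" "i \<in> {1..m}"
  shows "(left_pasting m m \<sigma> \<tau> ^^ 2) i = \<tau> (\<sigma> i)"
  using left_pasting_upper[of "\<sigma> i" m m] permutes_in_image[OF assms(1)] assms(2)
  by (simp add: numeral_2_eq_2 left_pasting_lower)

lemma left_pasting_square_upper:
  assumes "\<tau> permutes {1..m}" "i \<in> {1..m}"
  shows "(left_pasting m m \<sigma> \<tau> ^^ 2) (i + m) = \<sigma> (\<tau> i) + m"
  using left_pasting_lower[of "\<tau> i" m m] permutes_in_image[OF assms(1)] assms(2)
  by (simp add: numeral_2_eq_2 left_pasting_upper)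

text \<open>The order-preserving identifications of the two blocks with \<open>{1..2n + 1}\<close> are the identity and
  the shift by \<open>2n + 1\<close>. Under them, the square of the pasting acts as \<open>\<tau> \<circ> \<sigma>\<close> and \<open>\<sigma> \<circ> \<tau>\<close>
  respectively.\<close>

lemma simple_mixed_left_pasting:
  assumes \<sigma>: "\<sigma> permutes {1..2 * n + 1}" and \<tau>: "\<tau> permutes {1..2 * n + 1}"
    and \<tau>\<sigma>: "simple_odd n (\<tau> \<circ> \<sigma>)" and \<sigma>\<tau>: "simple_odd n (\<sigma> \<circ> \<tau>)"
  shows "simple_mixed n (left_pasting (2 * n + 1) (2 * n + 1) \<sigma> \<tau>)"
proof -
  define m where "m = 2 * n + 1"
  define \<theta> where "\<theta> = left_pasting m m \<sigma> \<tau>"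
  note perms = \<sigma>[folded m_def] \<tau>[folded m_def]
  have order: "4 * n + 2 = m + m"
    by (simp add: m_def)
  have block_1: "block n 1 = {1..m}" and block_2: "block n 2 = {m + 1..m + m}"
    by (simp_all add: block_def m_def)
  have "\<theta> permutes {1..4 * n + 2}"
    unfolding order \<theta>_def using perms by (rule left_pasting_permutes)
  moreover have "\<theta> ` block n 1 = block n 2" "\<theta> ` block n 2 = block n 1"
    unfolding block_1 block_2 \<theta>_def
    using perms by (simp_all only: left_pasting_image_lower left_pasting_image_upper)
  moreover have "\<exists>e \<rho>. bij_betw e {1..m} (block n 1) \<and> strict_mono_on {1..m} e \<and>
      simple_odd n \<rho> \<and> (\<forall>i\<in>{1..m}. (\<theta> ^^ 2) (e i) = e (\<rho> i))"
  proof (intro exI conjI)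
    show "bij_betw id {1..m} (block n 1)" "strict_mono_on {1..m} (id :: nat \<Rightarrow> nat)"
      unfolding block_1 by (simp_all add: strict_mono_on_def)
    show "\<forall>i\<in>{1..m}. (\<theta> ^^ 2) (id i) = id ((\<tau> \<circ> \<sigma>) i)"
      using left_pasting_square_lower[OF perms(1)] by (simp add: \<theta>_def)
  qed (rule \<tau>\<sigma>)
  moreover have "\<exists>e \<rho>. bij_betw e {1..m} (block n 2) \<and> strict_mono_on {1..m} e \<and>
      simple_odd n \<rho> \<and> (\<forall>i\<in>{1..m}. (\<theta> ^^ 2) (e i) = e (\<rho> i))"
  proof (intro exI conjI)
    show "bij_betw (\<lambda>i. i + m) {1..m} (block n 2)" "strict_mono_on {1..m} (\<lambda>i. i + m)"
      by (simp_all add: block_2 bij_betw_def strict_mono_on_def add.commute)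
    show "\<forall>i\<in>{1..m}. (\<theta> ^^ 2) (i + m) = (\<sigma> \<circ> \<tau>) i + m"
      using left_pasting_square_upper[OF perms(2)] by (simp add: \<theta>_def)
  qed (rule \<sigma>\<tau>)
  ultimately show ?thesis
    unfolding simple_mixed_def m_def[symmetric] \<theta>_def[symmetric] by simp
qed

theorem theorem3p2:
  fixes n :: nat
  assumes "n \<ge> 1"
  shows "simple_mixed n (left_pasting (2 * n + 1) (2 * n + 1) (alpha_perm n) id) \<and>
         simple_mixed n (left_pasting (2 * n + 1) (2 * n + 1) (beta_perm n) id) \<and>
         simple_mixed n (left_pasting (2 * n + 1) (2 * n + 1) id (alpha_perm n)) \<and>
         simple_mixed n (left_pasting (2 * n + 1) (2 * n + 1) id (beta_perm n))"
  using assms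
  by (intro conjI simple_mixed_left_pasting)
    (simp_all add: simple_odd_def alpha_perm_permutes beta_perm_permutes permutes_id
      del: One_nat_def Suc_eq_plus1)

end
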